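(* Let $n,r$ be integers with $r>0$ and $n\geqslant 0$. Then $\sigma_r\,\mathrm{mex}(n)=\widetilde D_2^{(r)}(n)$.
   Context: For a positive integer $r$, the $r$-gap of a partition $\lambda$ is the least positive integer that does not appear at least $r$ times as a part of $\lambda$. $\sigma_r\,\mathrm{mex}(n)$ is the sum of the $r$-gaps of all partitions of $n$. A partition of $n$ using two colors $0,1$ is a pair $(\lambda^{(0)},\lambda^{(1)})$ of partitions (the parts of color $0$ and of color $1$) with total size $n$. $\widetilde D_2^{(r)}(n)$ is the number of partitions of $n$ using two colors $0,1$ such that (i) $\lambda^{(0)}$ is a partition into distinct parts, each divisible by $r$, and (ii) $\lambda^{(1)}$ is a partition in which each part is repeated at most $2r-1$ times. *)

theory Defs
  imports Main "HOL-Library.Multiset"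
begin

definition partition_of :: "nat multiset \<Rightarrow> nat \<Rightarrow> bool" where
  "partition_of P n \<longleftrightarrow> (\<forall>p\<in>#P. 0 < p) \<and> sum_mset P = n"

(* The LEAST is attained whenever 0 < r, see r_gap_exists. *)
definition r_gap :: "nat \<Rightarrow> nat multiset \<Rightarrow> nat" where
  "r_gap r P = (LEAST k. 0 < k \<and> \<not> r \<le> count P k)"

definition sigma_mex :: "nat \<Rightarrow> nat \<Rightarrow> nat" where
  "sigma_mex r n = (\<Sum>P | partition_of P n. r_gap r P)"

definition two_colored_partition_of :: "nat multiset \<times> nat multiset \<Rightarrow> nat \<Rightarrow> bool" where
  "two_colored_partition_of c n \<longleftrightarrow>
     (\<exists>a b. partition_of (fst c) a \<and> partition_of (snd c) b \<and> a + b = n)"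

definition D2_set :: "nat \<Rightarrow> nat \<Rightarrow> (nat multiset \<times> nat multiset) set" where
  "D2_set r n = {c. two_colored_partition_of c n
      \<and> (\<forall>p\<in>#fst c. count (fst c) p = 1 \<and> r dvd p)
      \<and> (\<forall>p\<in>#snd c. count (snd c) p \<le> 2 * r - 1)}"

definition D2 :: "nat \<Rightarrow> nat \<Rightarrow> nat" where
  "D2 r n = card (D2_set r n)"

lemma r_gap_exists:
  fixes P :: "nat multiset"
  assumes "0 < r"
  shows "\<exists>k. 0 < k \<and> \<not> r \<le> count P k"
proof -
  obtain k where "k \<notin> insert 0 (set_mset P)"
    using ex_new_if_finite[OF infinite_UNIV_nat, of "insert 0 (set_mset P)"] by auto
  then show ?thesis
    using assms by (intro exI[of _ k]) (auto simp: not_in_iff)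
qed

lemma size_le_sum_mset:
  fixes M :: "nat multiset"
  assumes "\<forall>p\<in>#M. 0 < p"
  shows "size M \<le> sum_mset M"
  using assms by (induction M) auto

(* Finiteness rules out the junk values of sum and card on infinite sets. *)
lemma finite_partitions: "finite {P. partition_of P n}"
proof (rule finite_subset)
  show "{P. partition_of P n} \<subseteq> mset ` {xs. set xs \<subseteq> {..n} \<and> length xs \<le> n}"
  proof
    fix M assume "M \<in> {P. partition_of P n}"
    then have M: "\<forall>p\<in>#M. 0 < p" "sum_mset M = n"
      by (auto simp: partition_of_def)
    obtain xs where xs: "M = mset xs" by (metis ex_mset)
    have "length xs \<le> n" using size_le_sum_mset[OF M(1)] M(2) xs by simp
    moreover have "set xs \<subseteq> {..n}"
      using M(2) xs member_le_sum_list[of _ xs] by (auto simp: sum_mset_sum_list)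
    ultimately show "M \<in> mset ` {xs. set xs \<subseteq> {..n} \<and> length xs \<le> n}"
      using xs by auto
  qed
  show "finite (mset ` {xs. set xs \<subseteq> {..n} \<and> length xs \<le> n})"
    by (intro finite_imageI finite_lists_length_le) simp
qed

lemma finite_D2_set: "finite (D2_set r n)"
proof (rule finite_subset)
  show "D2_set r n \<subseteq> (\<Union>a\<le>n. {P. partition_of P a}) \<times> (\<Union>b\<le>n. {P. partition_of P b})"
    by (force simp: D2_set_def two_colored_partition_of_def)
  show "finite ((\<Union>a\<le>n. {P. partition_of P a}) \<times> (\<Union>b\<le>n. {P. partition_of P b}))"
    by (simp add: finite_partitions)
qed

end

(* Since k < r_gap r P iff each of 1, ..., k occurs at least r times in P, the generating function
   of sigma_mex is (SUM k. x^(k(k+1)/2)) / PROD (1 - q^i) with x = q^r.  That of D2 is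
   PROD (1 + x^i) (1 - x^(2i)) / PROD (1 - q^i).  The numerators agree by Gauss's identity for
   triangular numbers, of which a truncated version suffices; it comes from Shanks's finite
   identity, whose proof telescopes. *)

theory Submission
  imports Defs "HOL-Computational_Algebra.Formal_Power_Series"
begin

section \<open>Gauss's identity for triangular numbers\<close>

definition triangular :: "nat \<Rightarrow> nat" where
  "triangular k = (\<Sum>i=1..k. i)"

lemma triangular_Suc: "triangular (Suc k) = triangular k + Suc k"
  by (simp add: triangular_def)

lemma triangular_double: "triangular (2 * n) = n * (2 * n + 1)"
  by (induction n) (simp_all add: triangular_Suc, simp add: triangular_def)

lemma le_triangular: "k \<le> triangular k"
  by (cases k) (simp_all add: triangular_Suc)

text \<open>The q-Pochhammer symbol (x; x^2)_n. The ring is kept general so that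
  \<open>fps_X ^ r\<close> can be substituted for x later.\<close>

definition odd_prod :: "'a::comm_ring_1 \<Rightarrow> nat \<Rightarrow> 'a" where
  "odd_prod x n = (\<Prod>i<n. 1 - x ^ (2 * i + 1))"

lemma odd_prod_Suc: "odd_prod x (Suc n) = odd_prod x n * (1 - x ^ (2 * n + 1))"
  by (simp add: odd_prod_def)

text \<open>Compares the sum of \<open>shanks\<close> for n + 1, without its last summand, with 1 -
  x^(2n+1) times the sum for n: their partial sums differ by a single boundary term. Its product
  starts at i = m, so at m = 0 it contains 1 - x^0 = 0, and at m = Suc n it is empty.\<close>

lemma shanks_telescope:
  fixes x :: "'a::comm_ring_1"
  assumes "m \<le> Suc n"
  shows "(\<Sum>s<m. x ^ (s * (2 * n + 3)) * odd_prod x s * (\<Prod>i=Suc s..Suc n. 1 - x ^ (2 * i)))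
    = (\<Sum>s<m. (1 - x ^ (2 * n + 1)) * (x ^ (s * (2 * n + 1)) * odd_prod x s
        * (\<Prod>i=Suc s..n. 1 - x ^ (2 * i))))
      + x ^ (m * (2 * n + 1)) * odd_prod x m * (\<Prod>i=m..n. 1 - x ^ (2 * i))"
  using assms
proof (induction m)
  case 0
  have "(\<Prod>i=0..n. 1 - x ^ (2 * i)) = 0"
    by (rule prod_zero) (auto intro!: bexI[of _ 0])
  then show ?case by simp
next
  case (Suc m)
  define R where "R = (\<Prod>i=Suc m..n. 1 - x ^ (2 * i))"
  define y where "y = x ^ (m * (2 * n + 1))"
  have m: "m \<le> n" using Suc.prems by simp
  have R1: "(\<Prod>i=Suc m..Suc n. 1 - x ^ (2 * i)) = R * (1 - x ^ (2 * n + 2))"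
    using m by (simp add: R_def prod.nat_ivl_Suc')
  have R2: "(\<Prod>i=m..n. 1 - x ^ (2 * i)) = (1 - x ^ (2 * m)) * R"
    using m by (simp add: R_def prod.atLeast_Suc_atMost)
  have y1: "x ^ (m * (2 * n + 3)) = y * x ^ (2 * m)"
    by (simp only: y_def flip: power_add) (simp add: algebra_simps)
  have y2: "x ^ (Suc m * (2 * n + 1)) = y * x ^ (2 * n + 1)"
    by (simp only: y_def flip: power_add) (simp add: algebra_simps)
  have IH: "(\<Sum>s<m. x ^ (s * (2 * n + 3)) * odd_prod x s * (\<Prod>i=Suc s..Suc n. 1 - x ^ (2 * i)))
    = (\<Sum>s<m. (1 - x ^ (2 * n + 1)) * (x ^ (s * (2 * n + 1)) * odd_prod x s
        * (\<Prod>i=Suc s..n. 1 - x ^ (2 * i)))) + y * odd_prod x m * ((1 - x ^ (2 * m)) * R)"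
    using Suc.IH m unfolding R2 y_def by linarith
  have e: "x ^ (2 * n + 2) = x * x ^ (2 * n + 1)" "x ^ (2 * m + 1) = x * x ^ (2 * m)"
    by simp_all
  show ?case
    unfolding sum.lessThan_Suc IH R1 y1 y2 odd_prod_Suc
    unfolding R_def[symmetric] y_def[symmetric] e
    by (simp only: algebra_simps mult_1_left mult_1_right)
qed

text \<open>Shanks's identity with denominators cleared: a quotient of two products of 1 - x^(2i),
  up to n and up to s, appears as the product over s < i \<le> n, which makes sense in any
  commutative ring.\<close>

lemma shanks:
  fixes x :: "'a::comm_ring_1"
  shows "(\<Sum>s\<le>n. x ^ (s * (2 * n + 1)) * odd_prod x s * (\<Prod>i=Suc s..n. 1 - x ^ (2 * i)))
    = odd_prod x n * (\<Sum>k\<le>2 * n. x ^ triangular k)"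
proof (induction n)
  case 0
  show ?case by (simp add: odd_prod_def triangular_def)
next
  case (Suc n)
  have t: "triangular (Suc (2 * n)) = Suc n * (2 * n + 1)"
    "triangular (Suc (Suc (2 * n))) = Suc n * (2 * n + 3)"
    using triangular_double[of n] by (simp_all add: triangular_Suc algebra_simps)
  \<comment> \<open>The telescoping covers only s < Suc n, so the summand s = Suc n is split off. It
    supplies the power for the triangular number of 2n + 2, and the boundary term at m = Suc n the
    one for 2n + 1.\<close>
  have "(\<Sum>s\<le>Suc n. x ^ (s * (2 * Suc n + 1)) * odd_prod x s * (\<Prod>i=Suc s..Suc n. 1 - x ^ (2 * i)))
    = (\<Sum>s<Suc n. x ^ (s * (2 * n + 3)) * odd_prod x s * (\<Prod>i=Suc s..Suc n. 1 - x ^ (2 * i)))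
      + x ^ (Suc n * (2 * n + 3)) * odd_prod x (Suc n)"
    by (simp add: lessThan_Suc_atMost eval_nat_numeral)
  also have "\<dots> = (1 - x ^ (2 * n + 1)) * (odd_prod x n * (\<Sum>k\<le>2 * n. x ^ triangular k))
      + x ^ (Suc n * (2 * n + 1)) * odd_prod x (Suc n)
      + x ^ (Suc n * (2 * n + 3)) * odd_prod x (Suc n)"
    by (subst shanks_telescope)
      (simp_all only: order_refl sum_distrib_left[symmetric] lessThan_Suc_atMost Suc.IH, simp)
  also have "\<dots> = odd_prod x (Suc n) * (\<Sum>k\<le>2 * Suc n. x ^ triangular k)"
  proof -
    have "(\<Sum>k\<le>2 * Suc n. x ^ triangular k)
        = (\<Sum>k\<le>2 * n. x ^ triangular k)
          + x ^ triangular (Suc (2 * n)) + x ^ triangular (Suc (Suc (2 * n)))"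
      by simp
    then show ?thesis
      by (simp only: odd_prod_Suc distrib_left t) (simp only: ac_simps)
  qed
  finally show ?case .
qed

lemma prod_one_minus_power_split:
  fixes x :: "'a::comm_ring_1"
  shows "(\<Prod>i=1..2 * n. 1 - x ^ i) = odd_prod x n * (\<Prod>i=1..n. 1 - x ^ (2 * i))"
  by (induction n) (simp_all add: odd_prod_Suc ac_simps odd_prod_def)

text \<open>Each further factor 1 - x^j has j > n, so it is 1 modulo x^(n+1). Divisibility by
  \<open>x ^ Suc n\<close> stands in for equality of the coefficients up to n.\<close>

lemma power_dvd_prod_one_minus_diff:
  fixes x :: "'a::comm_ring_1"
  shows "x ^ Suc n dvd (\<Prod>i=1..n + k. 1 - x ^ i) - (\<Prod>i=1..n. 1 - x ^ i)"
proof (induction k)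
  case (Suc k)
  have "(\<Prod>i=1..n + Suc k. 1 - x ^ i) - (\<Prod>i=1..n. 1 - x ^ i)
    = ((\<Prod>i=1..n + k. 1 - x ^ i) - (\<Prod>i=1..n. 1 - x ^ i))
      - x ^ Suc n * (x ^ k * (\<Prod>i=1..n + k. 1 - x ^ i))"
    by (simp add: algebra_simps power_add)
  then show ?case
    using Suc by (metis dvd_diff dvd_triv_left)
qed simp

text \<open>Gauss's identity modulo x^(n+1). The factor PROD (1 - x^i) remains because it need not
  be cancellable in a general ring; \<open>gauss_triangular_fps\<close> removes it.\<close>

lemma gauss_triangular_mult:
  fixes x :: "'a::comm_ring_1"
  shows "x ^ Suc n dvd (\<Prod>i=1..n. 1 - x ^ i) * ((\<Sum>k\<le>n. x ^ triangular k)
    - (\<Prod>i=1..n. (1 + x ^ i) * (1 - x ^ (2 * i))))"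
proof -
  define F where "F m = (\<Prod>i=1..m. 1 - x ^ i)" for m
  define E where "E = (\<Prod>i=1..n. 1 - x ^ (2 * i))"
  define D where "D = (\<Prod>i=1..n. 1 + x ^ i)"
  define T where "T = (\<Sum>k\<le>2 * n. x ^ triangular k)"
  define U where "U = (\<Sum>k\<le>n. x ^ triangular k)"
  have FD: "F n * D = E"
    unfolding F_def D_def E_def prod.distrib[symmetric]
    by (intro prod.cong) (simp_all add: power_even_eq power2_eq_square, simp add: algebra_simps)
  \<comment> \<open>The summand s = 0 of \<open>shanks\<close> is E; every other exponent s(2n+1)
    exceeds n.\<close>
  have "odd_prod x n * T - E
      = (\<Sum>s=1..n. x ^ (s * (2 * n + 1)) * odd_prod x s * (\<Prod>i=Suc s..n. 1 - x ^ (2 * i)))"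
    unfolding T_def shanks[symmetric] E_def
    by (simp add: sum.atLeast_Suc_atMost atMost_atLeast0 odd_prod_def)
  moreover have "Suc n \<le> s * (2 * n + 1)" if "s \<in> {1..n}" for s
    using that mult_le_mono1[of 1 s "2 * n + 1"] by simp
  then have "x ^ Suc n dvd
      (\<Sum>s=1..n. x ^ (s * (2 * n + 1)) * odd_prod x s * (\<Prod>i=Suc s..n. 1 - x ^ (2 * i)))"
    by (intro dvd_sum dvd_mult2 le_imp_power_dvd)
  \<comment> \<open>Multiplying by E completes \<open>odd_prod x n\<close> to
    \<open>F (2 * n)\<close>, and rewriting one factor of E * E as \<open>F n * D\<close> makes
    \<open>F n\<close> appear in the other term.\<close>
  ultimately have "x ^ Suc n dvd E * (odd_prod x n * T - E)" by simp
  also have "E * (odd_prod x n * T - E) = odd_prod x n * E * T - F n * D * E"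
    by (simp only: FD) (simp add: algebra_simps)
  also have "\<dots> = F (2 * n) * T - F n * (D * E)"
    unfolding F_def[of "2 * n"] prod_one_minus_power_split E_def mult.assoc ..
  finally have 1: "x ^ Suc n dvd F (2 * n) * T - F n * (D * E)" .
  have 2: "x ^ Suc n dvd (F (2 * n) - F n) * T"
    using power_dvd_prod_one_minus_diff[of x n n] by (simp add: F_def mult_2)
  \<comment> \<open>The surplus exponents satisfy triangular k \<ge> k > n.\<close>
  have "T - U = (\<Sum>k=Suc n..2 * n. x ^ triangular k)"
    unfolding T_def U_def
    by (subst sum.subset_diff[of "{..n}" "{..2 * n}"]) (auto intro!: sum.cong)
  moreover have "x ^ Suc n dvd \<dots>"
    by (intro dvd_sum le_imp_power_dvd) (auto intro: le_trans[OF _ le_triangular])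
  ultimately have 3: "x ^ Suc n dvd F n * (T - U)" by simp
  have "F n * (U - D * E)
    = (F (2 * n) * T - F n * (D * E)) - (F (2 * n) - F n) * T - F n * (T - U)"
    by (simp add: algebra_simps)
  also have "x ^ Suc n dvd \<dots>"
    by (rule dvd_diff[OF dvd_diff[OF 1 2] 3])
  finally show ?thesis
    by (simp add: F_def U_def D_def E_def prod.distrib)
qed

section \<open>Partitions with prescribed multiplicities\<close>

text \<open>One product formula for this set covers all three cases: parts forced r times, distinct
  parts, and parts of bounded repetition.\<close>

definition parts_with_mult :: "nat set \<Rightarrow> (nat \<Rightarrow> nat set) \<Rightarrow> nat \<Rightarrow> nat multiset set" where
  "parts_with_mult S A n =
     {P. set_mset P \<subseteq> S \<and> (\<forall>i\<in>S. count P i \<in> A i) \<and> sum_mset P = n}"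

text \<open>For i > 0 this is the sum of x^(i k) over k in A, the factor that the part i
  contributes. Integer coefficients allow subtraction.\<close>

definition mult_fps :: "nat \<Rightarrow> nat set \<Rightarrow> int fps" where
  "mult_fps i A = Abs_fps (\<lambda>m. if i dvd m \<and> m div i \<in> A then 1 else 0)"

lemma finite_parts_with_mult:
  assumes "0 \<notin> S"
  shows "finite (parts_with_mult S A n)"
  by (rule finite_subset[OF _ finite_partitions[of n]])
    (use assms in \<open>auto simp: parts_with_mult_def partition_of_def intro!: gr0I\<close>)

text \<open>The copies of i account for m of the total size; removing them is a bijection. The
  resulting convolution is a coefficient of a Cauchy product, as the induction for
  \<open>fps_nth_prod_mult_fps\<close> requires.\<close>

lemma card_parts_with_mult_insert:
  assumes S: "0 \<notin> S" "i \<notin> S" "0 < i"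
  shows "card (parts_with_mult (insert i S) A n) =
    (\<Sum>m | m \<in> {0..n} \<and> i dvd m \<and> m div i \<in> A i. card (parts_with_mult S A (n - m)))"
    (is "_ = sum _ ?M")
proof -
  have "bij_betw (\<lambda>(m, P). P + replicate_mset (m div i) i)
    (SIGMA m:?M. parts_with_mult S A (n - m)) (parts_with_mult (insert i S) A n)"
  proof (rule bij_betw_byWitness[where f' = "\<lambda>Q. (i * count Q i, filter_mset (\<lambda>j. j \<noteq> i) Q)"])
    show "\<forall>c\<in>SIGMA m:?M. parts_with_mult S A (n - m).
      (\<lambda>Q. (i * count Q i, filter_mset (\<lambda>j. j \<noteq> i) Q))
        ((\<lambda>(m, P). P + replicate_mset (m div i) i) c) = c"
    proof
      fix c assume "c \<in> (SIGMA m:?M. parts_with_mult S A (n - m))"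
      then obtain m P where c: "c = (m, P)" and m: "i dvd m"
        and P: "P \<in> parts_with_mult S A (n - m)" by auto
      have "i \<notin># P" using P S by (auto simp: parts_with_mult_def)
      then have "count P i = 0" "filter_mset (\<lambda>j. j \<noteq> i) P = P"
        by (auto simp: not_in_iff multiset_eq_iff)
      then show "(\<lambda>Q. (i * count Q i, filter_mset (\<lambda>j. j \<noteq> i) Q))
        ((\<lambda>(m, P). P + replicate_mset (m div i) i) c) = c"
        using m by (auto simp: c multiset_eq_iff)
    qed
    have recompose: "filter_mset (\<lambda>j. j \<noteq> i) Q + replicate_mset (count Q i) i = Q" for Q
      by (auto simp: multiset_eq_iff)
    show "\<forall>Q\<in>parts_with_mult (insert i S) A n. (\<lambda>(m, P). P + replicate_mset (m div i) i)
      (i * count Q i, filter_mset (\<lambda>j. j \<noteq> i) Q) = Q"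
      using recompose S by simp
    show "(\<lambda>(m, P). P + replicate_mset (m div i) i) ` (SIGMA m:?M. parts_with_mult S A (n - m))
      \<subseteq> parts_with_mult (insert i S) A n"
    proof (rule image_subsetI)
      fix c assume "c \<in> (SIGMA m:?M. parts_with_mult S A (n - m))"
      then obtain m P where c: "c = (m, P)" and m: "m \<in> {0..n}" "i dvd m" "m div i \<in> A i"
        and P: "P \<in> parts_with_mult S A (n - m)" by auto
      have "i \<notin># P" using P S by (auto simp: parts_with_mult_def)
      then have "count P i = 0" by (simp add: not_in_iff)
      then show "(\<lambda>(m, P). P + replicate_mset (m div i) i) c \<in> parts_with_mult (insert i S) A n"
        using m P S by (auto simp: c parts_with_mult_def split: if_splits)
    qed
    show "(\<lambda>Q. (i * count Q i, filter_mset (\<lambda>j. j \<noteq> i) Q)) ` parts_with_mult (insert i S) A n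
      \<subseteq> (SIGMA m:?M. parts_with_mult S A (n - m))"
    proof (rule image_subsetI)
      fix Q assume Q: "Q \<in> parts_with_mult (insert i S) A n"
      have "sum_mset (filter_mset (\<lambda>j. j \<noteq> i) Q) + i * count Q i = n"
        using arg_cong[OF recompose[of Q], of sum_mset] Q
        by (simp add: parts_with_mult_def mult.commute)
      then show "(i * count Q i, filter_mset (\<lambda>j. j \<noteq> i) Q)
        \<in> (SIGMA m:?M. parts_with_mult S A (n - m))"
        using Q S by (auto simp: parts_with_mult_def)
    qed
  qed
  from bij_betw_same_card[OF this] show ?thesis
    using S by (simp add: finite_parts_with_mult)
qed

lemma fps_nth_prod_mult_fps:
  assumes "finite S" "0 \<notin> S"
  shows "fps_nth (\<Prod>i\<in>S. mult_fps i (A i)) n = int (card (parts_with_mult S A n))"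
  using assms
proof (induction S arbitrary: n rule: finite_induct)
  case empty
  have "parts_with_mult {} A n = (if n = 0 then {{#}} else {})"
    by (auto simp: parts_with_mult_def)
  then show ?case by simp
next
  case (insert i S)
  have "fps_nth (\<Prod>i\<in>insert i S. mult_fps i (A i)) n = (\<Sum>m=0..n.
      (if i dvd m \<and> m div i \<in> A i then 1 else 0) * int (card (parts_with_mult S A (n - m))))"
    using insert by (simp add: fps_mult_nth mult_fps_def)
  also have "\<dots> = (\<Sum>m=0..n.
      if i dvd m \<and> m div i \<in> A i then int (card (parts_with_mult S A (n - m))) else 0)"
    by (intro sum.cong) auto
  also have "\<dots> = int (card (parts_with_mult (insert i S) A n))"
    using insert.prems insert.hyps
    by (subst card_parts_with_mult_insert)
      (auto simp only: of_nat_sum sum.inter_filter finite_atLeastAtMost insert_iff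
        not_gr_zero of_nat_0 intro!: sum.cong split: if_split)
  finally show ?case .
qed

text \<open>No part exceeds the total size. Hence finite products over 1, ..., n can replace the
  infinite products of the generating functions.\<close>

lemma partition_of_iff_subset:
  "partition_of P m \<and> m \<le> n \<longleftrightarrow> set_mset P \<subseteq> {1..n} \<and> sum_mset P = m \<and> m \<le> n"
proof -
  have "p \<le> sum_mset P" if "p \<in># P" for p
    using that by (metis le_add1 multi_member_split sum_mset.add_mset)
  then show ?thesis
    by (fastforce simp: partition_of_def Suc_le_eq)
qed

text \<open>Geometric series: at the exponent i * k the coefficient is [k \<ge> r] -
  [k \<ge> r + 1]. The case r = 0 exhibits \<open>mult_fps i UNIV\<close> as the inverse of 1 -
  x^i.\<close>

lemma mult_fps_atLeast:
  assumes "0 < i"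
  shows "(1 - fps_X ^ i) * mult_fps i {r..} = fps_X ^ (r * i)"
proof (rule fps_ext)
  fix m
  show "fps_nth ((1 - fps_X ^ i) * mult_fps i {r..}) m = fps_nth (fps_X ^ (r * i)) m"
  proof (cases "i dvd m")
    case True
    then obtain k where m: "m = i * k" by auto
    then have "m = r * i \<longleftrightarrow> k = r" using assms by auto
    then show ?thesis
      using assms m
      by (cases k) (auto simp: mult_fps_def algebra_simps fps_X_power_mult_nth
          fps_X_power_mult_right_nth le_Suc_eq)
  next
    case False
    then have "\<not> i dvd m - i" if "i \<le> m" using that by (simp add: dvd_minus_self)
    moreover have "m \<noteq> r * i" using False by auto
    ultimately show ?thesis using False
      by (auto simp: mult_fps_def algebra_simps fps_X_power_mult_right_nth fps_X_power_mult_nth)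
  qed
qed

lemma mult_fps_disjoint_Un:
  assumes "A \<inter> B = {}"
  shows "mult_fps i (A \<union> B) = mult_fps i A + mult_fps i B"
  using assms by (auto simp: mult_fps_def fps_eq_iff)

text \<open>A finite geometric series, as the difference of the series starting at 0 and at
  r.\<close>

lemma mult_fps_lessThan:
  assumes "0 < i"
  shows "(1 - fps_X ^ i) * mult_fps i {..<r} = 1 - fps_X ^ (r * i)"
proof -
  have "mult_fps i {0..} = mult_fps i {..<r} + mult_fps i {r..}"
    by (subst mult_fps_disjoint_Un[symmetric]) (auto intro!: arg_cong[of _ _ "mult_fps i"])
  then have "(1 - fps_X ^ i) * mult_fps i {..<r} + fps_X ^ (r * i) = 1"
    using mult_fps_atLeast[OF assms, of 0] mult_fps_atLeast[OF assms, of r]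
    by (simp only: distrib_left) simp
  then show ?thesis by (simp add: eq_diff_eq)
qed

lemma mult_fps_01:
  assumes "0 < i"
  shows "mult_fps i {0, 1} = 1 + fps_X ^ i"
  using assms by (auto simp: mult_fps_def fps_eq_iff elim!: dvdE)

text \<open>The product of all 1/(1 - x^i), cut off at i = n; it agrees with the generating function
  of partitions in the coefficients up to n.\<close>

definition partition_fps :: "nat \<Rightarrow> int fps" where
  "partition_fps n = (\<Prod>i=1..n. mult_fps i UNIV)"

text \<open>Division by 1 - x^i, written as multiplication by its inverse. It brings out the common
  factor \<open>partition_fps\<close> in both generating functions.\<close>

lemma mult_fps_eq_mult_UNIV:
  assumes "0 < i" "(1 - fps_X ^ i) * mult_fps i A = f"
  shows "mult_fps i A = f * mult_fps i UNIV"
proof -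
  have "(1 - fps_X ^ i) * mult_fps i UNIV = 1"
    using mult_fps_atLeast[OF assms(1), of 0] by simp
  then show ?thesis
    by (metis assms(2) mult.assoc mult.commute mult.right_neutral)
qed

section \<open>The two generating functions\<close>

lemma less_r_gap_iff:
  assumes "0 < r"
  shows "k < r_gap r P \<longleftrightarrow> (\<forall>j\<in>{1..k}. r \<le> count P j)"
proof
  assume k: "k < r_gap r P"
  show "\<forall>j\<in>{1..k}. r \<le> count P j"
  proof
    fix j assume j: "j \<in> {1..k}"
    with k have "j < (LEAST k. 0 < k \<and> \<not> r \<le> count P k)"
      by (simp add: r_gap_def)
    from not_less_Least[OF this] j show "r \<le> count P j" by simp
  qed
next
  assume *: "\<forall>j\<in>{1..k}. r \<le> count P j"
  have "0 < r_gap r P \<and> \<not> r \<le> count P (r_gap r P)"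
    unfolding r_gap_def by (rule LeastI_ex[OF r_gap_exists[OF assms]])
  with * show "k < r_gap r P" by (metis Suc_leI One_nat_def atLeastAtMost_iff not_le)
qed

text \<open>The parts i \<le> k are forced r times and contribute x^(r i)/(1 - x^i); the exponents r
  i add up to r times a triangular number. By k \<le> n all forced parts lie in
  \<open>{1..n}\<close>.\<close>

lemma card_less_r_gap:
  assumes "0 < r" "k \<le> n"
  shows "int (card {P. partition_of P n \<and> k < r_gap r P})
    = fps_nth ((fps_X ^ r) ^ triangular k * partition_fps n) n"
proof -
  let ?A = "\<lambda>i. {if i \<le> k then r else 0..}"
  have "{P. partition_of P n \<and> k < r_gap r P} = parts_with_mult {1..n} ?A n"
    using assms partition_of_iff_subset[of _ n n]
    by (auto simp: less_r_gap_iff parts_with_mult_def)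
  then have "int (card {P. partition_of P n \<and> k < r_gap r P})
      = fps_nth (\<Prod>i=1..n. mult_fps i (?A i)) n"
    by (simp add: fps_nth_prod_mult_fps)
  also have "(\<Prod>i=1..n. mult_fps i (?A i))
      = (\<Prod>i=1..n. (if i \<le> k then fps_X ^ (r * i) else 1) * mult_fps i UNIV)"
    by (intro prod.cong mult_fps_eq_mult_UNIV refl) (auto simp: mult_fps_atLeast simp del: atLeast_0)
  also have "\<dots> = (\<Prod>i=1..n. if i \<le> k then fps_X ^ (r * i) else 1) * partition_fps n"
    by (simp only: prod.distrib partition_fps_def)
  also have "(\<Prod>i=1..n. if i \<le> k then fps_X ^ (r * i) else (1 :: int fps))
      = (\<Prod>i=1..k. (fps_X ^ r) ^ i)"
    using assms by (intro prod.mono_neutral_cong_right) (auto simp: power_mult)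
  also have "\<dots> = (fps_X ^ r) ^ triangular k"
    by (simp only: triangular_def power_sum)
  finally show ?thesis .
qed

text \<open>The gap is the number of k below it; exchanging the two summations leaves the counts of
  \<open>card_less_r_gap\<close>.\<close>

lemma sigma_mex_fps:
  assumes "0 < r"
  shows "int (sigma_mex r n)
    = fps_nth ((\<Sum>k\<le>n. (fps_X ^ r) ^ triangular k) * partition_fps n) n"
proof -
  have "r_gap r P = card {k. k \<le> n \<and> k < r_gap r P}" if P: "partition_of P n" for P
  proof -
    \<comment> \<open>A positive k below the gap occurs at least r > 0 times, so it is a part and at
      most n. This makes the range of k independent of P, as the exchange of sums requires.\<close>
    have "k \<le> n" if k: "k < r_gap r P" for k
    proof (cases "k = 0")
      case False
      then have "r \<le> count P k"
        using k assms by (auto simp: less_r_gap_iff)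
      then have "k \<in># P"
        using assms by (auto simp flip: count_greater_zero_iff)
      then show ?thesis using P partition_of_iff_subset[of P n n] by (auto simp: subset_iff)
    qed simp
    then have "{k. k \<le> n \<and> k < r_gap r P} = {..<r_gap r P}" by auto
    then show ?thesis by simp
  qed
  then have "sigma_mex r n = (\<Sum>P | partition_of P n. \<Sum>k | k \<in> {..n} \<and> k < r_gap r P. 1)"
    by (simp add: sigma_mex_def)
  also have "\<dots> = (\<Sum>k\<le>n. \<Sum>P | P \<in> {P. partition_of P n} \<and> k < r_gap r P. 1)"
    by (subst sum.swap_restrict) (simp_all add: finite_partitions)
  finally have "int (sigma_mex r n)
      = (\<Sum>k\<le>n. int (card {P. partition_of P n \<and> k < r_gap r P}))"
    by simp
  also have "\<dots> = (\<Sum>k\<le>n. fps_nth ((fps_X ^ r) ^ triangular k * partition_fps n) n)"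
    using assms by (intro sum.cong) (simp_all add: card_less_r_gap)
  finally show ?thesis
    by (simp add: sum_distrib_right fps_sum_nth)
qed

text \<open>Convolution over the size a of color 0. Color 0 contributes the factors 1 + x^(r i),
  color 1 the factors (1 - x^(2 r i))/(1 - x^i).\<close>

lemma D2_fps:
  assumes "0 < r"
  shows "int (D2 r n) = fps_nth
    ((\<Prod>i=1..n. (1 + (fps_X ^ r) ^ i) * (1 - (fps_X ^ r) ^ (2 * i))) * partition_fps n) n"
proof -
  \<comment> \<open>The multiples run up to r * n, beyond any possible part, so that i ranges over
    1, ..., n exactly as in Gauss's product.\<close>
  let ?S = "(*) r ` {1..n}"
  let ?C0 = "parts_with_mult ?S (\<lambda>_. {0, 1})" and ?C1 = "parts_with_mult {1..n} (\<lambda>_. {..<2 * r})"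
  have color0: "partition_of P a \<and> (\<forall>p\<in>#P. count P p = 1 \<and> r dvd p) \<longleftrightarrow> P \<in> ?C0 a"
    if "a \<le> n" for P a
  proof
    assume P: "partition_of P a \<and> (\<forall>p\<in>#P. count P p = 1 \<and> r dvd p)"
    have "p \<in> ?S" if "p \<in># P" for p
    proof -
      have "r dvd p" using P that by blast
      then obtain k where k: "p = r * k" by (rule dvdE)
      have "p \<in> {1..n}" using partition_of_iff_subset[of P a n] P \<open>a \<le> n\<close> that by blast
      then have "1 \<le> k" "r * k \<le> n" using k by (cases k; simp)+
      moreover have "k \<le> r * k" using assms by simp
      ultimately have "k \<in> {1..n}" by (meson atLeastAtMost_iff order_trans)
      then show ?thesis using k by blast
    qed
    then show "P \<in> ?C0 a"
      using P by (auto simp: parts_with_mult_def partition_of_def not_in_iff)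
  next
    assume "P \<in> ?C0 a"
    then have P: "set_mset P \<subseteq> ?S" "\<forall>p\<in>?S. count P p \<in> {0, 1}" "sum_mset P = a"
      by (auto simp: parts_with_mult_def)
    have "0 < p \<and> count P p = 1 \<and> r dvd p" if "p \<in># P" for p
    proof -
      have "p \<in> ?S" using P(1) that by blast
      moreover from this have "count P p \<in> {0, 1}" by (rule bspec[OF P(2)])
      moreover have "count P p \<noteq> 0" using that by (simp add: not_in_iff)
      ultimately show ?thesis using assms by auto
    qed
    then show "partition_of P a \<and> (\<forall>p\<in>#P. count P p = 1 \<and> r dvd p)"
      using P(3) by (simp add: partition_of_def)
  qed
  have color1: "partition_of P b \<and> (\<forall>p\<in>#P. count P p \<le> 2 * r - 1) \<longleftrightarrow> P \<in> ?C1 b"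
    if "b \<le> n" for P b
  proof -
    \<comment> \<open>Absent values have multiplicity 0 < 2 * r, so the bound may range over all p;
      r > 0 also makes the natural subtraction in \<open>2 * r - 1\<close> exact.\<close>
    have "(\<forall>p\<in>#P. count P p \<le> 2 * r - 1) \<longleftrightarrow> (\<forall>p. count P p < 2 * r)"
    proof -
      have "count P p < 2 * r \<longleftrightarrow> count P p \<le> 2 * r - 1" for p
        using assms by auto
      moreover have "p \<notin># P \<Longrightarrow> count P p < 2 * r" for p
        using assms by (simp add: not_in_iff)
      ultimately show ?thesis by metis
    qed
    moreover have "(\<forall>p\<in>{1..n}. count P p < 2 * r) \<longleftrightarrow> (\<forall>p. count P p < 2 * r)"
      if "set_mset P \<subseteq> {1..n}"
      using assms that by (metis mult_pos_pos not_in_iff subsetD zero_less_numeral)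
    ultimately show ?thesis
      using partition_of_iff_subset[of P b n] that by (auto simp: parts_with_mult_def)
  qed
  have "D2_set r n = (\<Union>a\<in>{0..n}. ?C0 a \<times> ?C1 (n - a))"
  proof (rule set_eqI)
    fix c
    have "c \<in> D2_set r n \<longleftrightarrow> (\<exists>a\<in>{0..n}.
       (partition_of (fst c) a \<and> (\<forall>p\<in>#fst c. count (fst c) p = 1 \<and> r dvd p)) \<and>
       (partition_of (snd c) (n - a) \<and> (\<forall>p\<in>#snd c. count (snd c) p \<le> 2 * r - 1)))"
      unfolding D2_set_def two_colored_partition_of_def by (force simp: partition_of_def)
    also have "\<dots> \<longleftrightarrow> (\<exists>a\<in>{0..n}. fst c \<in> ?C0 a \<and> snd c \<in> ?C1 (n - a))"
      by (intro bex_cong refl) (simp only: color0 color1 atLeastAtMost_iff diff_le_self)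
    also have "\<dots> \<longleftrightarrow> c \<in> (\<Union>a\<in>{0..n}. ?C0 a \<times> ?C1 (n - a))"
      by (simp only: UN_iff mem_Times_iff)
    finally show "c \<in> D2_set r n \<longleftrightarrow> c \<in> (\<Union>a\<in>{0..n}. ?C0 a \<times> ?C1 (n - a))" .
  qed
  \<comment> \<open>The union is disjoint because a is the sum of the first component.\<close>
  moreover have "card (\<Union>a\<in>{0..n}. ?C0 a \<times> ?C1 (n - a))
      = (\<Sum>a=0..n. card (?C0 a \<times> ?C1 (n - a)))"
  proof (intro card_UN_disjoint ballI impI)
    show "finite (?C0 a \<times> ?C1 (n - a))" for a
      using assms by (intro finite_cartesian_product finite_parts_with_mult) auto
  qed (auto simp: parts_with_mult_def)
  ultimately have "int (D2 r n) = (\<Sum>a=0..n. int (card (?C0 a)) * int (card (?C1 (n - a))))"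
    by (simp add: D2_def card_cartesian_product)
  also have "\<dots> = fps_nth ((\<Prod>i\<in>?S. mult_fps i {0, 1}) * (\<Prod>i=1..n. mult_fps i {..<2 * r})) n"
    using assms by (subst fps_mult_nth, intro sum.cong refl, subst (1 2) fps_nth_prod_mult_fps) auto
  also have "(\<Prod>i\<in>?S. mult_fps i {0, 1}) = (\<Prod>i=1..n. 1 + (fps_X ^ r) ^ i)"
    using assms by (subst prod.reindex)
      (auto simp: inj_on_def mult_fps_01 power_mult simp del: One_nat_def intro!: prod.cong)
  also have "(\<Prod>i=1..n. mult_fps i {..<2 * r})
      = (\<Prod>i=1..n. (1 - (fps_X ^ r) ^ (2 * i)) * mult_fps i UNIV)"
    by (intro prod.cong mult_fps_eq_mult_UNIV refl)
      (auto simp: mult_fps_lessThan ac_simps simp flip: power_mult)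
  finally show ?thesis
    by (simp add: prod.distrib partition_fps_def mult.assoc)
qed

text \<open>The case x = \<open>fps_X ^ r\<close> of \<open>gauss_triangular_mult\<close>; r > 0
  makes \<open>fps_X ^ Suc n\<close> divide \<open>x ^ Suc n\<close>. For power series PROD (1 -
  x^i) is invertible, and multiplying by the series \<open>mult_fps (r * i) UNIV\<close> cancels
  it.\<close>

lemma gauss_triangular_fps:
  assumes "0 < r"
  shows "fps_X ^ Suc n dvd (\<Sum>k\<le>n. (fps_X ^ r) ^ triangular k)
    - (\<Prod>i=1..n. (1 + (fps_X ^ r) ^ i) * (1 - (fps_X ^ r) ^ (2 * i)) :: int fps)"
    (is "_ dvd ?G")
proof -
  have "fps_X ^ Suc n dvd (fps_X ^ r) ^ Suc n"
    unfolding power_mult[symmetric]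
    using assms by (intro le_imp_power_dvd) (cases r; simp)
  then have "fps_X ^ Suc n dvd
      (\<Prod>i=1..n. mult_fps (r * i) UNIV) * ((\<Prod>i=1..n. 1 - (fps_X ^ r) ^ i) * ?G)"
    by (intro dvd_mult dvd_trans[OF _ gauss_triangular_mult])
  also have "\<dots> = (\<Prod>i=1..n. mult_fps (r * i) UNIV * (1 - fps_X ^ (r * i))) * ?G"
    by (simp only: prod.distrib mult.assoc power_mult)
  also have "(\<Prod>i=1..n. mult_fps (r * i) UNIV * (1 - fps_X ^ (r * i))) = 1"
    using assms mult_fps_atLeast[of _ 0] by (intro prod.neutral) (auto simp: mult.commute)
  finally show ?thesis by simp
qed

theorem theorem7:
  fixes n r :: nat
  assumes "0 < r"
  shows "sigma_mex r n = D2 r n"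
proof -
  obtain h where h: "(\<Sum>k\<le>n. (fps_X ^ r) ^ triangular k)
      - (\<Prod>i=1..n. (1 + (fps_X ^ r) ^ i) * (1 - (fps_X ^ r) ^ (2 * i)) :: int fps)
      = fps_X ^ Suc n * h"
    using gauss_triangular_fps[OF assms, of n] by (elim dvdE)
  \<comment> \<open>Both numbers are the coefficient at n of a numerator times the same
    \<open>partition_fps n\<close>, and the numerators differ by a multiple of
    \<open>fps_X ^ Suc n\<close>.\<close>
  have "int (sigma_mex r n) - int (D2 r n) = fps_nth (fps_X ^ Suc n * (h * partition_fps n)) n"
    unfolding sigma_mex_fps[OF assms] D2_fps[OF assms] mult.assoc[symmetric] h[symmetric]
    by (simp only: left_diff_distrib fps_sub_nth)
  also have "\<dots> = 0"
    by (simp only: fps_X_power_mult_nth) simp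
  finally show ?thesis by simp
qed

end
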